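(* Let $D$ be an integral domain. Then $D[X]_A$ is a locally $v$-domain if and only if $D$ is a locally $v$-domain.
   Context: $X$ is an indeterminate over $D$, $A=\{f\in D[X]\mid f(0)=1\}$, and $D[X]_A$ is the localization at $A$. For an integral domain $E$ with quotient field $K$ and nonzero fractional ideal $I$, $I^{-1}=\{x\in K\mid xI\subseteq E\}$ and $I_v=(I^{-1})^{-1}$. $E$ is a $v$-domain if $(II^{-1})_v=E$ for every nonzero finitely generated ideal $I$ of $E$. $E$ is a locally $v$-domain if $E_P$ is a $v$-domain for every prime ideal $P$ of $E$. *)

theory Defs
  imports "HOL-Computational_Algebra.Polynomial" "HOL-Computational_Algebra.Fraction_Field"
begin

text \<open>Integral domains are represented as subrings E of a field 'k
(the quotient field of E is the subfield of 'k generated by E; the inverse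
and v-operations of fractional ideals computed inside 'k coincide with those
computed inside the quotient field of E).\<close>

definition subring_of :: "'k::field set \<Rightarrow> bool" where
  "subring_of E \<longleftrightarrow> 0 \<in> E \<and> 1 \<in> E \<and>
     (\<forall>x\<in>E. \<forall>y\<in>E. x + y \<in> E \<and> x - y \<in> E \<and> x * y \<in> E)"

definition ideal_of :: "'k::field set \<Rightarrow> 'k set \<Rightarrow> bool" where
  "ideal_of E I \<longleftrightarrow> I \<subseteq> E \<and> 0 \<in> I \<and>
     (\<forall>x\<in>I. \<forall>y\<in>I. x + y \<in> I) \<and> (\<forall>r\<in>E. \<forall>x\<in>I. r * x \<in> I)"

definition prime_ideal_of :: "'k::field set \<Rightarrow> 'k set \<Rightarrow> bool" where
  "prime_ideal_of E P \<longleftrightarrow> ideal_of E P \<and> P \<noteq> E \<and>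
     (\<forall>a\<in>E. \<forall>b\<in>E. a * b \<in> P \<longrightarrow> a \<in> P \<or> b \<in> P)"

definition fin_gen_ideal :: "'k::field set \<Rightarrow> 'k set \<Rightarrow> bool" where
  "fin_gen_ideal E I \<longleftrightarrow> (\<exists>(n::nat) (g::nat \<Rightarrow> 'k). (\<forall>i<n. g i \<in> E) \<and>
      I = {\<Sum>i<n. r i * g i | r::nat \<Rightarrow> 'k. \<forall>i<n. r i \<in> E})"

definition frac_inv :: "'k::field set \<Rightarrow> 'k set \<Rightarrow> 'k set" where
  "frac_inv E I = {x. \<forall>y\<in>I. x * y \<in> E}"

definition v_closure :: "'k::field set \<Rightarrow> 'k set \<Rightarrow> 'k set" where
  "v_closure E I = frac_inv E (frac_inv E I)"

definition set_prod :: "'k::field set \<Rightarrow> 'k set \<Rightarrow> 'k set" where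
  "set_prod I J = {\<Sum>i<n. a i * b i | (n::nat) (a::nat \<Rightarrow> 'k) b. \<forall>i<n. a i \<in> I \<and> b i \<in> J}"

definition v_domain :: "'k::field set \<Rightarrow> bool" where
  "v_domain E \<longleftrightarrow> (\<forall>I. fin_gen_ideal E I \<and> I \<noteq> {0} \<longrightarrow>
      v_closure E (set_prod I (frac_inv E I)) = E)"

definition localization :: "'k::field set \<Rightarrow> 'k set \<Rightarrow> 'k set" where
  "localization E S = {a / s | a s. a \<in> E \<and> s \<in> S}"

definition locally_v_domain :: "'k::field set \<Rightarrow> bool" where
  "locally_v_domain E \<longleftrightarrow>
     (\<forall>P. prime_ideal_of E P \<longrightarrow> v_domain (localization E (E - P)))"

end

theory Submission
  imports Defs "HOL-Computational_Algebra.Polynomial_Factorial"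
begin

text \<open>In elementary terms, \<open>E\<close> is a v-domain iff \<open>(I\<^sup>-\<^sup>1 : I\<^sup>-\<^sup>1) = E\<close> for all nonzero finitely
  generated \<open>I\<close>. If \<open>E\<close> is a v-domain with quotient field \<open>K\<close>, then Dedekind-Mertens gives: if
  \<open>f, g \<in> K[X]\<close> and \<open>fg \<in> E[X]\<close>, then \<open>c(f) c(g) \<subseteq> E\<close>. Up to a scalar, every finitely generated
  ideal of a localization \<open>T\<close> of \<open>E[X]\<close> is generated by polynomials that are coprime in \<open>K[X]\<close>; when
  \<open>T\<close> inverts only polynomials of unit content, the multipliers of its inverse therefore reduce to
  multipliers of \<open>C\<^sup>-\<^sup>1\<close>, where \<open>C\<close> is generated by all coefficients involved. Hence \<open>T\<close> is a
  v-domain iff \<open>E\<close> is. For a prime \<open>Q\<close> of \<open>D[X]\<close> with \<open>P = Q \<inter> D\<close>, the ring \<open>D[X]\<^sub>Q\<close> is such a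
  localization of \<open>D\<^sub>P[X]\<close>, since a polynomial outside \<open>Q\<close> has a coefficient outside \<open>P\<close>. Finally,
  every prime \<open>P\<close> of \<open>D\<close> is the contraction of \<open>P + X D[X]\<close>, which is disjoint from \<open>A\<close>.\<close>

section \<open>A Dedekind-Mertens lemma\<close>

text \<open>These products generate the \<open>n\<close>-th power of the content ideal
  \<open>c(f)\<close>.\<close>

primrec coeff_products :: "'a::comm_ring_1 poly \<Rightarrow> nat \<Rightarrow> 'a set" where
  "coeff_products f 0 = {1}"
| "coeff_products f (Suc n) = {coeff f i * u | i u. u \<in> coeff_products f n}"

lemma coeff_products_SucI: "u \<in> coeff_products f n \<Longrightarrow> coeff f i * u \<in> coeff_products f (Suc n)"
  by auto

lemma sum_in_additive_subgroup:
  fixes W :: "'a::ab_group_add set"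
  assumes "0 \<in> W" and diff: "\<And>x y. x \<in> W \<Longrightarrow> y \<in> W \<Longrightarrow> x - y \<in> W"
    and "\<And>i. i \<in> A \<Longrightarrow> h i \<in> W"
  shows "sum h A \<in> W"
proof -
  have add: "x + y \<in> W" if "x \<in> W" "y \<in> W" for x y
    using diff[OF that(1) diff[OF \<open>0 \<in> W\<close> that(2)]] by simp
  show ?thesis
    using assms(3) by (induction A rule: infinite_finite_induct) (auto simp: \<open>0 \<in> W\<close> add)
qed

text \<open>The classical form \<open>c(f)^(n+1) c(g) \<subseteq> c(f)^n c(fg)\<close> is the case where \<open>W\<close> is the
  right-hand side; a general additive subgroup \<open>W\<close> makes the induction on \<open>n\<close> go through.\<close>
lemma dedekind_mertens:
  fixes f g :: "'a::comm_ring_1 poly"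
  assumes "0 \<in> W" and "\<And>x y. x \<in> W \<Longrightarrow> y \<in> W \<Longrightarrow> x - y \<in> W"
    and "\<And>j. j > n \<Longrightarrow> coeff g j = 0"
    and "\<And>u k. u \<in> coeff_products f n \<Longrightarrow> u * coeff (f * g) k \<in> W"
    and "u \<in> coeff_products f (Suc n)"
  shows "u * coeff g j \<in> W"
  using assms
proof (induction n arbitrary: g W u j)
  case 0
  then obtain i where u: "u = coeff f i" by auto
  have "g = [:coeff g 0:]"
    using 0(3) by (intro poly_eqI) (auto simp: coeff_pCons split: nat.split)
  then have "coeff (f * g) i = coeff f i * coeff g 0"
    by (metis coeff_smult mult.commute mult_pCons_right mult_zero_right pCons_0_0 add.right_neutral)
  with 0(4)[of 1 i] have "u * coeff g 0 \<in> W" by (simp add: u)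
  with 0(1,3) show ?case by (cases j) auto
next
  case (Suc n)
  \<comment> \<open>The term of degree \<open>Suc n\<close> is split off from \<open>g\<close>. Once
    the products involving \<open>c\<close> are known to lie in \<open>W\<close>, the induction
    hypothesis takes care of the rest \<open>g'\<close>.\<close>
  define c where "c = coeff g (Suc n)"
  define g' where "g' = g - monom c (Suc n)"
  have g'_coeff: "coeff g' j = (if j = Suc n then 0 else coeff g j)" for j
    by (simp add: g'_def c_def)
  have g'_deg: "coeff g' j = 0" if "j > n" for j
    using that Suc.prems(3)[of j] by (auto simp: g'_coeff)
  have prod: "coeff (f * g') k = coeff (f * g) k - (if k < Suc n then 0 else c * coeff f (k - Suc n))" for k
  proof -
    have "f * g' = f * g - monom c (Suc n) * f" by (simp add: g'_def algebra_simps)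
    then show ?thesis by (simp only: coeff_diff coeff_monom_mult)
  qed
  have lower: "coeff f i * (u * coeff g' j) \<in> W"
    if top: "\<And>u. u \<in> coeff_products f (Suc n) \<Longrightarrow> coeff f i * (u * c) \<in> W"
      and u: "u \<in> coeff_products f (Suc n)" for i u j
  proof -
    \<comment> \<open>The induction hypothesis is applied to the subgroup of all \<open>y\<close>
      with \<open>f_i y\<close> in \<open>W\<close>. The extra factor \<open>f_i\<close> turns an
      \<open>n\<close>-fold product \<open>v\<close> into an \<open>(n+1)\<close>-fold one, for
      which the assumption on \<open>f * g\<close> is available.\<close>
    have "u * coeff g' j \<in> {y. coeff f i * y \<in> W}"
    proof (rule Suc.IH[OF _ _ g'_deg _ u])
      fix v k assume v: "v \<in> coeff_products f n"
      have 1: "coeff f i * v * coeff (f * g) k \<in> W"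
        using Suc.prems(4)[OF coeff_products_SucI[OF v]] .
      have 2: "coeff f i * (coeff f (k - Suc n) * v * c) \<in> W"
        using top[OF coeff_products_SucI[OF v]] .
      have "coeff f i * (v * coeff (f * g') k) \<in> W"
        using 1 Suc.prems(2)[OF 1 2] by (simp add: prod algebra_simps)
      then show "v * coeff (f * g') k \<in> {y. coeff f i * y \<in> W}" by simp
    qed (use Suc.prems(1,2) in \<open>auto simp: algebra_simps\<close>)
    then show ?thesis by simp
  qed
  \<comment> \<open>Descending induction on \<open>i\<close>. In the coefficient of
    \<open>f * g'\<close> at \<open>i + n + 1\<close>, the terms with \<open>a > i\<close> lie in
    \<open>W\<close> by the induction hypothesis and \<open>lower\<close>, and those with
    \<open>a \<le> i\<close> vanish for degree reasons. Comparison with the same coefficient of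
    \<open>f * g\<close> leaves \<open>f_i c\<close>.\<close>
  have top: "coeff f i * (u * c) \<in> W" if "u \<in> coeff_products f (Suc n)" for i u
    using that
  proof (induction "degree f - i" arbitrary: i u rule: less_induct)
    case less
    show ?case
    proof (cases "i > degree f")
      case True
      then show ?thesis using Suc.prems(1) by (simp add: coeff_eq_0)
    next
      case False
      let ?N = "i + Suc n"
      have "u * (coeff f a * coeff g' (?N - a)) \<in> W" for a
      proof (cases "i < a")
        case True
        have "coeff f a * (v * c) \<in> W" if "v \<in> coeff_products f (Suc n)" for v
        proof (cases "a \<le> degree f")
          case True
          with \<open>i < a\<close> show ?thesis by (intro less.hyps that) auto
        next
          case False
          then show ?thesis using Suc.prems(1) by (simp add: coeff_eq_0)
        qed
        from lower[OF this less.prems, of "?N - a"] show ?thesis by (simp add: algebra_simps)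
      next
        case False
        then have "coeff g' (?N - a) = 0" by (intro g'_deg) auto
        then show ?thesis using Suc.prems(1) by simp
      qed
      then have "u * coeff (f * g') ?N \<in> W"
        unfolding coeff_mult sum_distrib_left
        by (intro sum_in_additive_subgroup Suc.prems(1,2)) auto
      from Suc.prems(2)[OF Suc.prems(4)[OF less.prems, of ?N] this]
      show ?thesis by (simp add: prod algebra_simps)
    qed
  qed
  from Suc.prems(5) obtain i v where u: "u = coeff f i * v" and v: "v \<in> coeff_products f (Suc n)"
    by (subst (asm) coeff_products.simps(2)) blast
  show ?case
  proof (cases "j = Suc n")
    case True
    then show ?thesis using top[OF v, of i] by (simp add: u c_def algebra_simps)
  next
    case False
    then show ?thesis using lower[OF top v, of i j] by (simp add: u g'_coeff algebra_simps)
  qed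
qed

section \<open>An elementwise form of the v-domain condition\<close>

lemma subring_ofD:
  assumes "subring_of E"
  shows "0 \<in> E" "1 \<in> E" "x \<in> E \<Longrightarrow> y \<in> E \<Longrightarrow> x + y \<in> E" "x \<in> E \<Longrightarrow> y \<in> E \<Longrightarrow> x - y \<in> E"
    "x \<in> E \<Longrightarrow> y \<in> E \<Longrightarrow> x * y \<in> E" "(\<And>i. i \<in> A \<Longrightarrow> h i \<in> E) \<Longrightarrow> sum h A \<in> E"
proof -
  show *: "0 \<in> E" "1 \<in> E" "x \<in> E \<Longrightarrow> y \<in> E \<Longrightarrow> x + y \<in> E" "x \<in> E \<Longrightarrow> y \<in> E \<Longrightarrow> x - y \<in> E"
    "x \<in> E \<Longrightarrow> y \<in> E \<Longrightarrow> x * y \<in> E" for x y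
    using assms by (auto simp: subring_of_def)
  show "(\<And>i. i \<in> A \<Longrightarrow> h i \<in> E) \<Longrightarrow> sum h A \<in> E"
    by (rule sum_in_additive_subgroup) (use * in auto)
qed

text \<open>For the fractional ideal \<open>I\<close> generated by \<open>G\<close>, the inner condition says
  \<open>x I\<^sup>-\<^sup>1 \<subseteq> I\<^sup>-\<^sup>1\<close>; so this is \<open>(I\<^sup>-\<^sup>1 : I\<^sup>-\<^sup>1) = E\<close> for all such \<open>I\<close>.\<close>
definition v_closed :: "'k::field set \<Rightarrow> bool" where
  "v_closed E \<longleftrightarrow> (\<forall>G x. finite G \<and> (\<exists>g\<in>G. g \<noteq> 0) \<and>
     (\<forall>z. (\<forall>g\<in>G. z * g \<in> E) \<longrightarrow> (\<forall>g\<in>G. x * z * g \<in> E)) \<longrightarrow> x \<in> E)"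

lemma v_closedD:
  assumes "v_closed E" "finite G" "g \<in> G" "g \<noteq> 0"
    and "\<And>z g. (\<And>g. g \<in> G \<Longrightarrow> z * g \<in> E) \<Longrightarrow> g \<in> G \<Longrightarrow> x * z * g \<in> E"
  shows "x \<in> E"
  using assms unfolding v_closed_def by meson

lemma frac_inv_self: "subring_of E \<Longrightarrow> frac_inv E E = E"
  using subring_ofD(2,5)[of E] by (fastforce simp: frac_inv_def)

text \<open>\<open>E\<close> is its own inverse, and the inverse of \<open>H\<close> multiplies
  \<open>H_v\<close> into \<open>E\<close>; so \<open>H_v = E\<close> forces the inverse of
  \<open>H\<close> into \<open>E\<close>. Conversely, that inverse contains \<open>E\<close> because
  \<open>H\<close> is integral, so it equals \<open>E\<close> and its inverse is again
  \<open>E\<close>.\<close>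

lemma v_closure_eq_ring_iff:
  assumes "subring_of E" "H \<subseteq> E"
  shows "v_closure E H = E \<longleftrightarrow> frac_inv E H \<subseteq> E"
proof
  assume "v_closure E H = E"
  then have "frac_inv E (v_closure E H) = E" using frac_inv_self[OF assms(1)] by simp
  moreover have "x \<in> frac_inv E (v_closure E H)" if "x \<in> frac_inv E H" for x
    using that by (auto simp: frac_inv_def[of E "v_closure E H"])
      (auto simp: v_closure_def frac_inv_def[of E "frac_inv E H"] mult.commute)
  ultimately show "frac_inv E H \<subseteq> E" by blast
next
  assume "frac_inv E H \<subseteq> E"
  moreover have "E \<subseteq> frac_inv E H" using assms subring_ofD(5) by (auto simp: frac_inv_def)
  ultimately show "v_closure E H = E"
    using frac_inv_self[OF assms(1)] by (simp add: v_closure_def subset_antisym)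
qed

text \<open>The inverse of \<open>I I^{-1}\<close> is the multiplier ring
  \<open>(I^{-1} : I^{-1})\<close>, and membership in \<open>I^{-1}\<close> can be tested on the
  generators of \<open>I\<close>.\<close>

lemma v_closure_set_prod_iff:
  fixes n :: nat
  assumes E: "subring_of E" and I: "I = {\<Sum>i<n. r i * g i | r. \<forall>i<n. r i \<in> E}"
  shows "v_closure E (set_prod I (frac_inv E I)) = E \<longleftrightarrow>
    (\<forall>x. (\<forall>z. (\<forall>i<n. z * g i \<in> E) \<longrightarrow> (\<forall>i<n. x * z * g i \<in> E)) \<longrightarrow> x \<in> E)"
proof -
  note E' = subring_ofD[OF E]
  have gen: "g i \<in> I" if "i < n" for i
  proof -
    have "g i = (\<Sum>j<n. (if j = i then 1 else 0) * g j)"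
      using that by (simp add: if_distrib[of "\<lambda>c. c * _"] cong: if_cong)
    then show ?thesis unfolding I using E' by (auto intro!: exI[of _ "\<lambda>j. if j = i then 1 else 0"])
  qed
  have span: "z * y \<in> E" if z: "\<And>i. i < n \<Longrightarrow> z * g i \<in> E" and y: "y \<in> I" for z y
  proof -
    obtain r where r: "y = (\<Sum>i<n. r i * g i)" "\<forall>i<n. r i \<in> E" using y unfolding I by auto
    have "z * y = (\<Sum>i<n. r i * (z * g i))" by (simp add: r(1) sum_distrib_left algebra_simps)
    also have "\<dots> \<in> E" using z r(2) by (intro E'(6)) (blast intro: E'(5))
    finally show ?thesis .
  qed
  have inv: "z \<in> frac_inv E I \<longleftrightarrow> (\<forall>i<n. z * g i \<in> E)" for z
    unfolding frac_inv_def using gen span by auto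
  have "set_prod I (frac_inv E I) \<subseteq> E"
    unfolding set_prod_def frac_inv_def
    by (auto intro!: E'(6) simp: mult.commute)
  then have 1: "v_closure E (set_prod I (frac_inv E I)) = E
      \<longleftrightarrow> (\<forall>x. x \<in> frac_inv E (set_prod I (frac_inv E I)) \<longrightarrow> x \<in> E)"
    using v_closure_eq_ring_iff[OF E] by blast
  have 2: "x \<in> frac_inv E (set_prod I (frac_inv E I)) \<longleftrightarrow>
      (\<forall>z. z \<in> frac_inv E I \<longrightarrow> (\<forall>i<n. x * z * g i \<in> E))" for x
  proof
    assume x: "x \<in> frac_inv E (set_prod I (frac_inv E I))"
    show "\<forall>z. z \<in> frac_inv E I \<longrightarrow> (\<forall>i<n. x * z * g i \<in> E)"
    proof (intro allI impI)
      fix z i assume "z \<in> frac_inv E I" "i < n"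
      then have "g i * z \<in> set_prod I (frac_inv E I)"
        unfolding set_prod_def
        by (intro CollectI exI[of _ "1::nat"] exI[of _ "\<lambda>_. g i"] exI[of _ "\<lambda>_. z"]) (auto intro: gen)
      with x have "x * (g i * z) \<in> E" unfolding frac_inv_def[of E "set_prod I (frac_inv E I)"] by blast
      then show "x * z * g i \<in> E" by (simp only: mult.commute mult.left_commute)
    qed
  next
    assume x: "\<forall>z. z \<in> frac_inv E I \<longrightarrow> (\<forall>i<n. x * z * g i \<in> E)"
    show "x \<in> frac_inv E (set_prod I (frac_inv E I))"
      unfolding frac_inv_def[of E "set_prod _ _"]
    proof safe
      fix y assume "y \<in> set_prod I (frac_inv E I)"
      then obtain m a b where y: "y = (\<Sum>i<m. a i * b i)"
        and ab: "\<forall>i<(m::nat). a i \<in> I \<and> b i \<in> frac_inv E I"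
        unfolding set_prod_def by blast
      have "x * y = (\<Sum>i<m. x * b i * a i)" by (simp add: y sum_distrib_left algebra_simps)
      also have "\<dots> \<in> E"
      proof (rule E'(6))
        fix i assume "i \<in> {..<m}"
        with ab have "a i \<in> I" "b i \<in> frac_inv E I" by auto
        with x show "x * b i * a i \<in> E" by - (rule span, blast+)
      qed
      finally show "x * y \<in> E" .
    qed
  qed
  show ?thesis unfolding 1 2 inv ..
qed

text \<open>The assumption \<open>quot\<close> says that the ambient field is the quotient field of
  \<open>E\<close>.\<close>

lemma common_denominator:
  assumes E: "subring_of E" and quot: "\<And>x. \<exists>d\<in>E. d \<noteq> 0 \<and> d * x \<in> E" and "finite G"
  obtains d where "d \<in> E" "d \<noteq> 0" "\<And>g. g \<in> G \<Longrightarrow> d * g \<in> E"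
proof -
  from \<open>finite G\<close> have "\<exists>d\<in>E. d \<noteq> 0 \<and> (\<forall>g\<in>G. d * g \<in> E)"
  proof induction
    case empty
    show ?case using subring_ofD(2)[OF E] by (intro bexI[of _ 1]) auto
  next
    case (insert g G)
    then obtain d where d: "d \<in> E" "d \<noteq> 0" "\<forall>g\<in>G. d * g \<in> E" by blast
    obtain e where e: "e \<in> E" "e \<noteq> 0" "e * g \<in> E" using quot by blast
    have "e * d * h \<in> E" if "h \<in> G" for h
      using subring_ofD(5)[OF E e(1), of "d * h"] d(3) that by (simp add: mult.assoc)
    moreover have "e * d * g \<in> E"
      using subring_ofD(5)[OF E d(1) e(3)] by (simp add: algebra_simps)
    ultimately show ?case
      using d e subring_ofD(5)[OF E] by (intro bexI[of _ "e * d"]) auto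
  qed
  then show ?thesis using that by blast
qed

text \<open>\<open>v_domain\<close> speaks of ideals inside \<open>E\<close>,
  \<open>v_closed\<close> of arbitrary finite sets of generators in the field. A common denominator
  \<open>d\<close> moves the generators into \<open>E\<close>, and replacing \<open>z\<close> by
  \<open>z * d\<close> shows that this scaling preserves the condition on \<open>x\<close>.\<close>

lemma v_domain_iff_v_closed:
  assumes E: "subring_of E" and quot: "\<And>x. \<exists>d\<in>E. d \<noteq> 0 \<and> d * x \<in> E"
  shows "v_domain E \<longleftrightarrow> v_closed E"
proof
  assume v: "v_domain E"
  show "v_closed E"
    unfolding v_closed_def
  proof (intro allI impI, elim conjE bexE)
    fix G x g0
    assume fin: "finite G" and g0: "g0 \<in> G" "g0 \<noteq> 0"
      and x: "\<forall>z. (\<forall>g\<in>G. z * g \<in> E) \<longrightarrow> (\<forall>g\<in>G. x * z * g \<in> E)"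
    obtain d where d: "d \<in> E" "d \<noteq> 0" "\<And>g. g \<in> G \<Longrightarrow> d * g \<in> E"
      by (rule common_denominator[OF E quot fin]) blast
    obtain h and n :: nat where h: "G = h ` {..<n}"
      using fin by (metis finite_imp_nat_seg_image_inj_on lessThan_def)
    define I where "I = {\<Sum>i<n. r i * (d * h i) | r. \<forall>i<n. r i \<in> E}"
    have "fin_gen_ideal E I"
      unfolding fin_gen_ideal_def I_def by (intro exI[of _ n] exI[of _ "\<lambda>i. d * h i"]) (use d h in auto)
    moreover have "I \<noteq> {0}"
    proof -
      obtain i where i: "i < n" "g0 = h i" using g0 h by auto
      have "d * h i = (\<Sum>j<n. (if j = i then 1 else 0) * (d * h j))"
        using i by (simp add: if_distrib[of "\<lambda>c. c * _"] cong: if_cong)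
      then have "d * g0 \<in> I"
        unfolding I_def using subring_ofD[OF E] i
        by (auto intro!: exI[of _ "\<lambda>j. if j = i then 1 else 0"])
      with d g0 show ?thesis by auto
    qed
    ultimately have "v_closure E (set_prod I (frac_inv E I)) = E"
      using v by (simp add: v_domain_def)
    then have *: "(\<forall>z. (\<forall>i<n. z * (d * h i) \<in> E) \<longrightarrow> (\<forall>i<n. x * z * (d * h i) \<in> E)) \<longrightarrow> x \<in> E"
      unfolding v_closure_set_prod_iff[OF E I_def] by blast
    have "\<forall>z. (\<forall>i<n. z * (d * h i) \<in> E) \<longrightarrow> (\<forall>i<n. x * z * (d * h i) \<in> E)"
    proof (intro allI impI)
      fix z i assume "\<forall>i<n. z * (d * h i) \<in> E" "i < n"
      then have "x * (z * d) * h i \<in> E"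
        using x[rule_format, of "z * d" "h i"] by (auto simp: h mult.assoc)
      then show "x * z * (d * h i) \<in> E" by (simp only: mult.assoc)
    qed
    with * show "x \<in> E" by blast
  qed
next
  assume v: "v_closed E"
  show "v_domain E"
    unfolding v_domain_def
  proof (intro allI impI, elim conjE)
    fix I assume "fin_gen_ideal E I" and ne: "I \<noteq> {0}"
    then obtain n and g :: "nat \<Rightarrow> 'a" where g: "\<forall>i<n. g i \<in> E"
      and I: "I = {\<Sum>i<n. r i * g i | r. \<forall>i<n. r i \<in> E}"
      unfolding fin_gen_ideal_def by blast
    have "\<exists>i<n. g i \<noteq> 0"
    proof (rule ccontr)
      assume "\<not> ?thesis"
      then have "I = {0}" unfolding I using subring_ofD(1)[OF E] by (auto intro!: exI[of _ "\<lambda>_. 0"])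
      with ne show False by simp
    qed
    then obtain i where i: "i < n" "g i \<noteq> 0" by blast
    show "v_closure E (set_prod I (frac_inv E I)) = E"
      unfolding v_closure_set_prod_iff[OF E I]
    proof (intro allI impI)
      fix x assume x: "\<forall>z. (\<forall>i<n. z * g i \<in> E) \<longrightarrow> (\<forall>i<n. x * z * g i \<in> E)"
      show "x \<in> E"
        by (rule v_closedD[OF v, of "g ` {..<n}" "g i"]) (use i x in auto)
    qed
  qed
qed

section \<open>Gauss's lemma over a v-domain\<close>

lemma finite_coeff_products: "finite (coeff_products f n)"
proof (induction n)
  case (Suc n)
  have "coeff_products f (Suc n) \<subseteq> (\<lambda>(i, u). coeff f i * u) ` ({..Suc (degree f)} \<times> coeff_products f n)"
  proof
    fix w assume "w \<in> coeff_products f (Suc n)"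
    then obtain i u where w: "w = coeff f i * u" "u \<in> coeff_products f n" by auto
    \<comment> \<open>Indices are capped one past the degree, where the coefficient is zero, so that
      vanishing factors are represented too.\<close>
    have "coeff f i = coeff f (min i (Suc (degree f)))" by (simp add: min_def coeff_eq_0)
    with w show "w \<in> (\<lambda>(i, u). coeff f i * u) ` ({..Suc (degree f)} \<times> coeff_products f n)"
      by (intro image_eqI[of _ _ "(min i (Suc (degree f)), u)"]) auto
  qed
  then show ?case using Suc.IH finite_subset by blast
qed auto

lemma power_in_coeff_products: "coeff f i ^ n \<in> coeff_products f n"
  by (induction n) auto

text \<open>By Dedekind-Mertens, \<open>f\<^sub>i g\<^sub>j\<close> maps the nonzero finitely generated module \<open>W = c(f)\<^sup>n\<close>
  into itself.\<close>
lemma v_closed_gauss: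
  fixes f g :: "'k::field poly"
  assumes E: "subring_of E" and v: "v_closed E" and fg: "\<And>k. coeff (f * g) k \<in> E"
  shows "coeff f i * coeff g j \<in> E"
proof (cases "f = 0")
  case True
  then show ?thesis using subring_ofD(1)[OF E] by simp
next
  case False
  note E' = subring_ofD[OF E]
  define n where "n = degree g"
  define P where "P = coeff_products f n"
  have fin: "finite P" unfolding P_def by (rule finite_coeff_products)
  define W where "W = {\<Sum>u\<in>P. r u * u | r. \<forall>u\<in>P. r u \<in> E}"
  have W0: "0 \<in> W" unfolding W_def using E'(1) by (auto intro!: exI[of _ "\<lambda>_. 0"])
  have Wdiff: "x - y \<in> W" if xy: "x \<in> W" "y \<in> W" for x y
  proof -
    obtain r s where "x = (\<Sum>u\<in>P. r u * u)" "\<forall>u\<in>P. r u \<in> E" "y = (\<Sum>u\<in>P. s u * u)" "\<forall>u\<in>P. s u \<in> E"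
      using xy unfolding W_def by blast
    then have "x - y = (\<Sum>u\<in>P. (r u - s u) * u)" "\<forall>u\<in>P. r u - s u \<in> E"
      using E'(4) by (auto simp: sum_subtractf algebra_simps)
    then show ?thesis unfolding W_def by (intro CollectI exI[of _ "\<lambda>u. r u - s u"] conjI)
  qed
  have Wmult: "u * e \<in> W" if "u \<in> P" "e \<in> E" for u e
  proof -
    have "u * e = (\<Sum>w\<in>P. (if w = u then e else 0) * w)"
      using that fin by (simp add: if_distrib[of "\<lambda>c. c * _"] cong: if_cong)
    then show ?thesis unfolding W_def using E'(1) that
      by (auto intro!: exI[of _ "\<lambda>w. if w = u then e else 0"])
  qed
  \<comment> \<open>Since \<open>f_i u\<close> is an \<open>(n+1)\<close>-fold product and
    \<open>n\<close> bounds the degree of \<open>g\<close>, Dedekind-Mertens puts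
    \<open>f_i u g_j\<close> into \<open>W\<close>.\<close>
  have xP: "coeff f i * u * coeff g j \<in> W" if "u \<in> P" for u
  proof (rule dedekind_mertens[OF W0 Wdiff])
    show "coeff g j = 0" if "j > n" for j using that by (simp add: n_def coeff_eq_0)
    show "u * coeff (f * g) k \<in> W" if "u \<in> coeff_products f n" for u k
      using Wmult fg that by (simp add: P_def)
    show "coeff f i * u \<in> coeff_products f (Suc n)"
      using that coeff_products_SucI by (simp add: P_def)
  qed
  show ?thesis
  proof (rule v_closedD[OF v fin])
    show "lead_coeff f ^ n \<in> P" unfolding P_def by (rule power_in_coeff_products)
    show "lead_coeff f ^ n \<noteq> 0" using False by simp
    fix z u assume z: "\<And>u. u \<in> P \<Longrightarrow> z * u \<in> E" and u: "u \<in> P"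
    have "z * w \<in> E" if "w \<in> W" for w
    proof -
      obtain r where r: "w = (\<Sum>u\<in>P. r u * u)" "\<forall>u\<in>P. r u \<in> E" using \<open>w \<in> W\<close> unfolding W_def by blast
      have "z * w = (\<Sum>u\<in>P. r u * (z * u))" by (simp add: r(1) sum_distrib_left algebra_simps)
      also have "\<dots> \<in> E" using z r(2) by (intro E'(6)) (blast intro: E'(5))
      finally show ?thesis .
    qed
    from this[OF xP[OF u]] show "coeff f i * coeff g j * z * u \<in> E" by (simp add: algebra_simps)
  qed
qed

section \<open>Localizations of a polynomial ring\<close>

text \<open>\<open>K[X]\<close> is Euclidean: a nonzero combination \<open>h\<close> of least degree
  divides every member of the family, since the remainder \<open>f g mod h\<close> is again a
  combination.\<close>

lemma Bezout_poly_family: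
  fixes f :: "'b \<Rightarrow> 'k::field poly"
  assumes "g \<in> G" "f g \<noteq> 0" "finite G"
  obtains h r where "h \<noteq> 0" "h = (\<Sum>g\<in>G. r g * f g)" "\<And>g. g \<in> G \<Longrightarrow> h dvd f g"
proof -
  define J where "J = {\<Sum>g\<in>G. r g * f g | r. True}"
  have fJ: "f g \<in> J" if "g \<in> G" for g
  proof -
    have "f g = (\<Sum>i\<in>G. (if i = g then 1 else 0) * f i)"
      using that \<open>finite G\<close> by (simp add: if_distrib[of "\<lambda>c. c * _"] cong: if_cong)
    then show ?thesis
      unfolding J_def by (intro CollectI exI[of _ "\<lambda>i. if i = g then 1 else 0"] conjI TrueI)
  qed
  have "\<exists>h. (h \<in> J \<and> h \<noteq> 0) \<and> (\<forall>y. y \<in> J \<and> y \<noteq> 0 \<longrightarrow> degree h \<le> degree y)"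
    by (rule ex_has_least_nat[of _ "f g"]) (use assms fJ in auto)
  then obtain h where h: "h \<in> J" "h \<noteq> 0" and min: "\<And>y. y \<in> J \<Longrightarrow> y \<noteq> 0 \<Longrightarrow> degree h \<le> degree y"
    by blast
  obtain r where r: "h = (\<Sum>g\<in>G. r g * f g)" using h unfolding J_def by blast
  have "h dvd f g" if g: "g \<in> G" for g
  proof -
    obtain s where s: "f g = (\<Sum>g\<in>G. s g * f g)" using fJ[OF g] unfolding J_def by blast
    have "f g mod h = f g - (f g div h) * h" by (simp add: minus_div_mult_eq_mod)
    also have "\<dots> = (\<Sum>i\<in>G. (s i - (f g div h) * r i) * f i)"
    proof -
      have "(f g div h) * h = (\<Sum>i\<in>G. (f g div h) * r i * f i)"
        by (subst (2) r) (simp add: sum_distrib_left mult.assoc)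
      then show ?thesis by (subst s) (simp add: sum_subtractf left_diff_distrib)
    qed
    finally have "f g mod h \<in> J"
      unfolding J_def by (intro CollectI exI[of _ "\<lambda>i. s i - (f g div h) * r i"] conjI TrueI)
    then have "f g mod h = 0" using min degree_mod_less[OF h(2), of "f g"] by fastforce
    then show ?thesis by (rule mod_0_imp_dvd)
  qed
  with h r show ?thesis using that by blast
qed

text \<open>\<open>\<iota>\<close> embeds \<open>K[X]\<close> into its field of fractions. The assumption on \<open>s \<in> S\<close> expresses that
  \<open>c(s)\<^sup>-\<^sup>1 = E\<close>.\<close>
locale primitive_localization =
  fixes \<iota> :: "'k::field poly \<Rightarrow> 'l::field" and E :: "'k set" and S :: "'k poly set"
  assumes hom_add: "\<iota> (p + q) = \<iota> p + \<iota> q"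
    and hom_mult: "\<iota> (p * q) = \<iota> p * \<iota> q"
    and hom_1: "\<iota> 1 = 1"
    and hom_inj: "\<iota> p = 0 \<Longrightarrow> p = 0"
    and quotients: "\<exists>p q. q \<noteq> 0 \<and> x * \<iota> q = \<iota> p"
    and E: "subring_of E"
    and E_quotients: "\<And>x. \<exists>d\<in>E. d \<noteq> 0 \<and> d * x \<in> E"
    and S_one: "1 \<in> S"
    and S_mult: "s \<in> S \<Longrightarrow> t \<in> S \<Longrightarrow> s * t \<in> S"
    and S_nonzero: "0 \<notin> S"
    and S_coeff: "s \<in> S \<Longrightarrow> coeff s i \<in> E"
    and S_primitive: "s \<in> S \<Longrightarrow> (\<And>i. y * coeff s i \<in> E) \<Longrightarrow> y \<in> E"
begin

lemmas Es = subring_ofD[OF E]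

definition E_polys :: "'k poly set" where "E_polys = {p. \<forall>i. coeff p i \<in> E}"

definition T :: "'l set" where "T = {\<iota> t / \<iota> s | t s. t \<in> E_polys \<and> s \<in> S}"

lemma hom_0: "\<iota> 0 = 0"
  using hom_add[of 0 0] by (simp only: add_0_right add_cancel_right_right)

lemma hom_eq_0_iff: "\<iota> p = 0 \<longleftrightarrow> p = 0"
  using hom_inj hom_0 by auto

lemma hom_diff: "\<iota> (p - q) = \<iota> p - \<iota> q"
  using hom_add[of "p - q" q] by simp

lemma hom_eq_iff: "\<iota> p = \<iota> q \<longleftrightarrow> p = q"
  using hom_eq_0_iff[of "p - q"] by (simp add: hom_diff)

lemma hom_sum: "\<iota> (sum f A) = (\<Sum>i\<in>A. \<iota> (f i))"
  by (induction A rule: infinite_finite_induct) (auto simp: hom_0 hom_add)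

lemma E_polys_mult: "p \<in> E_polys \<Longrightarrow> q \<in> E_polys \<Longrightarrow> p * q \<in> E_polys"
  unfolding E_polys_def mem_Collect_eq coeff_mult by (intro allI Es(6) Es(5)) auto

lemma S_subset_E_polys: "S \<subseteq> E_polys"
  using S_coeff by (auto simp: E_polys_def)

text \<open>Written without division, membership of the image of a polynomial turns, by
  \<open>hom_eq_iff\<close>, into an identity in \<open>K[X]\<close>.\<close>

lemma T_iff: "x \<in> T \<longleftrightarrow> (\<exists>s\<in>S. \<exists>t\<in>E_polys. \<iota> s * x = \<iota> t)"
proof
  assume "x \<in> T"
  then obtain t s where "x = \<iota> t / \<iota> s" "t \<in> E_polys" "s \<in> S" unfolding T_def by blast
  moreover from this have "\<iota> s \<noteq> 0" using S_nonzero hom_eq_0_iff by auto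
  ultimately show "\<exists>s\<in>S. \<exists>t\<in>E_polys. \<iota> s * x = \<iota> t"
    by (intro bexI[of _ s] bexI[of _ t]) auto
next
  assume "\<exists>s\<in>S. \<exists>t\<in>E_polys. \<iota> s * x = \<iota> t"
  then obtain s t where st: "s \<in> S" "t \<in> E_polys" "\<iota> s * x = \<iota> t" by blast
  then have "\<iota> s \<noteq> 0" using S_nonzero hom_eq_0_iff by auto
  with st have "x = \<iota> t / \<iota> s" by (simp add: field_simps)
  with st show "x \<in> T" unfolding T_def by blast
qed

lemma hom_E_polys_in_T: "p \<in> E_polys \<Longrightarrow> \<iota> p \<in> T"
  unfolding T_iff by (intro bexI[of _ 1] bexI[of _ p]) (auto simp: hom_1 S_one)

lemma hom_E_polys_mult_T: "p \<in> E_polys \<Longrightarrow> x \<in> T \<Longrightarrow> \<iota> p * x \<in> T"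
  unfolding T_iff using E_polys_mult by (metis hom_mult mult.left_commute)

lemma T_common_denominator:
  assumes "finite G" "\<And>g. g \<in> G \<Longrightarrow> x g \<in> T"
  obtains s t where "s \<in> S" "\<And>g. g \<in> G \<Longrightarrow> t g \<in> E_polys" "\<And>g. g \<in> G \<Longrightarrow> \<iota> s * x g = \<iota> (t g)"
proof -
  have "\<exists>s\<in>S. \<forall>g\<in>G. \<exists>t\<in>E_polys. \<iota> s * x g = \<iota> t"
    using assms
  proof (induction G)
    case empty
    then show ?case using S_one by auto
  next
    case (insert g G)
    then obtain s where s: "s \<in> S" "\<forall>g\<in>G. \<exists>t\<in>E_polys. \<iota> s * x g = \<iota> t" by auto
    obtain s' t' where s': "s' \<in> S" "t' \<in> E_polys" "\<iota> s' * x g = \<iota> t'"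
      using insert.prems[of g] unfolding T_iff by auto
    have "\<exists>t\<in>E_polys. \<iota> (s * s') * x h = \<iota> t" if h: "h \<in> insert g G" for h
    proof (cases "h = g")
      case True
      have "\<iota> (s * s') * x h = \<iota> (s * t')" using s' True by (simp add: hom_mult mult.assoc)
      then show ?thesis using s s' S_subset_E_polys E_polys_mult by blast
    next
      case False
      then obtain t where t: "t \<in> E_polys" "\<iota> s * x h = \<iota> t" using s h by blast
      then have "\<iota> (s * s') * x h = \<iota> (s' * t)" by (simp add: hom_mult algebra_simps)
      then show ?thesis using t s' S_subset_E_polys E_polys_mult by blast
    qed
    then show ?case using S_mult[OF s(1) s'(1)] by blast
  qed
  then obtain s where "s \<in> S" "\<forall>g\<in>G. \<exists>t. t \<in> E_polys \<and> \<iota> s * x g = \<iota> t" by blast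
  moreover from this(2) obtain t where "\<forall>g\<in>G. t g \<in> E_polys \<and> \<iota> s * x g = \<iota> (t g)" by metis
  ultimately show ?thesis using that by blast
qed

section \<open>Finite families of fractions of polynomials\<close>

lemma quotients_finite:
  assumes "finite G"
  shows "\<exists>q. q \<noteq> 0 \<and> (\<forall>g\<in>G. \<exists>p. g * \<iota> q = \<iota> p)"
  using assms
proof induction
  case empty
  show ?case by (intro exI[of _ 1]) simp
next
  case (insert g G)
  then obtain q where q: "q \<noteq> 0" "\<forall>g\<in>G. \<exists>p. g * \<iota> q = \<iota> p" by blast
  obtain q' p' where q': "q' \<noteq> 0" "g * \<iota> q' = \<iota> p'" using quotients by blast
  have "\<exists>p. h * \<iota> (q' * q) = \<iota> p" if h: "h \<in> insert g G" for h
  proof (cases "h = g")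
    case True
    then show ?thesis using q' by (intro exI[of _ "p' * q"]) (simp add: hom_mult flip: mult.assoc)
  next
    case False
    then obtain p where "h * \<iota> q = \<iota> p" using q h by blast
    then show ?thesis by (intro exI[of _ "q' * p"]) (simp add: hom_mult mult.left_commute)
  qed
  with q q' show ?case by (intro exI[of _ "q' * q"]) auto
qed

text \<open>Clear denominators and divide by a greatest common divisor \<open>h\<close>. The Bezout
  relation with value 1 later recovers \<open>x\<close> from its products with the
  \<open>f g\<close>.\<close>

lemma coprime_representation:
  assumes "finite G" "g0 \<in> G" "g0 \<noteq> 0"
  obtains c f r where "c \<noteq> 0" "\<And>g. g \<in> G \<Longrightarrow> g = c * \<iota> (f g)" "(\<Sum>g\<in>G. r g * f g) = 1"
proof -
  obtain q where q: "q \<noteq> 0" "\<forall>g\<in>G. \<exists>p. g * \<iota> q = \<iota> p"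
    using quotients_finite[OF assms(1)] by blast
  then obtain p where p: "\<And>g. g \<in> G \<Longrightarrow> g * \<iota> q = \<iota> (p g)" by metis
  have q0: "\<iota> q \<noteq> 0" using q hom_eq_0_iff by simp
  have "p g0 \<noteq> 0" using p[OF assms(2)] assms(3) q0 hom_0 by auto
  then obtain h r where h: "h \<noteq> 0" "h = (\<Sum>g\<in>G. r g * p g)" "\<And>g. g \<in> G \<Longrightarrow> h dvd p g"
    using Bezout_poly_family[OF assms(2) _ assms(1)] by metis
  define f where "f g = p g div h" for g
  have f: "p g = h * f g" if "g \<in> G" for g using h(3)[OF that] by (simp add: f_def)
  show ?thesis
  proof (rule that[of "\<iota> h / \<iota> q" f r])
    show "\<iota> h / \<iota> q \<noteq> 0" using h(1) q0 hom_eq_0_iff by simp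
    show "g = \<iota> h / \<iota> q * \<iota> (f g)" if "g \<in> G" for g
      using p[OF that] q0 by (simp add: f[OF that] hom_mult field_simps)
    have "h * (\<Sum>g\<in>G. r g * f g) = (\<Sum>g\<in>G. r g * p g)"
      by (simp add: f sum_distrib_left algebra_simps)
    then have "h * (\<Sum>g\<in>G. r g * f g) = h * 1" using h(2) by simp
    then show "(\<Sum>g\<in>G. r g * f g) = 1" using h(1) by simp
  qed
qed

text \<open>Let \<open>C\<close> consist of the coefficients of the coprime polynomials
  \<open>f g\<close>. The Bezout relation gives \<open>s x = w\<close> with \<open>s\<close> in
  \<open>S\<close> and \<open>w\<close> in \<open>K[X]\<close>. It then suffices that every
  coefficient of \<open>w\<close> multiplies the inverse of \<open>C\<close> into itself.\<close>

lemma v_closed_localization: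
  assumes v: "v_closed E"
  shows "v_closed T"
  unfolding v_closed_def
proof (intro allI impI, elim conjE bexE)
  fix G x g0
  assume fin: "finite G" and g0: "g0 \<in> G" "g0 \<noteq> 0"
    and x: "\<forall>z. (\<forall>g\<in>G. z * g \<in> T) \<longrightarrow> (\<forall>g\<in>G. x * z * g \<in> T)"
  obtain c f r where c: "c \<noteq> 0" and f: "\<And>g. g \<in> G \<Longrightarrow> g = c * \<iota> (f g)"
    and r: "(\<Sum>g\<in>G. r g * f g) = 1"
    by (rule coprime_representation[OF fin g0]) blast
  define C where "C = (\<lambda>(g, i). coeff (f g) i) ` (SIGMA g:G. {..degree (f g)})"
  have finC: "finite C" unfolding C_def using fin by auto
  have C_iff: "(\<forall>e\<in>C. d * e \<in> E) \<longleftrightarrow> (\<forall>g\<in>G. smult d (f g) \<in> E_polys)" for d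
  proof
    assume *: "\<forall>e\<in>C. d * e \<in> E"
    show "\<forall>g\<in>G. smult d (f g) \<in> E_polys"
      unfolding E_polys_def
    proof clarsimp
      fix g i assume "g \<in> G"
      then show "d * coeff (f g) i \<in> E"
        using * Es(1) by (cases "i \<le> degree (f g)") (auto simp: C_def coeff_eq_0)
    qed
  qed (auto simp: C_def E_polys_def)
  \<comment> \<open>For \<open>d\<close> in the inverse of \<open>C\<close>, the element
    \<open>d / c\<close> lies in the inverse of \<open>G\<close>, so the hypothesis on
    \<open>x\<close> applies to it.\<close>
  have x_mult: "x * \<iota> (smult d (f g)) \<in> T" if d: "\<forall>e\<in>C. d * e \<in> E" and "g \<in> G" for d g
  proof -
    have "x * (\<iota> [:d:] / c) * g \<in> T"
    proof (rule x[rule_format])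
      fix h assume "h \<in> G"
      then have "\<iota> [:d:] / c * h = \<iota> (smult d (f h))"
        by (subst f) (use c in \<open>auto simp flip: hom_mult\<close>)
      with d \<open>h \<in> G\<close> show "\<iota> [:d:] / c * h \<in> T" unfolding C_iff by (simp add: hom_E_polys_in_T)
    qed (use that in auto)
    moreover have "x * (\<iota> [:d:] / c) * g = x * \<iota> (smult d (f g))"
      by (subst f) (use c that in \<open>auto simp: mult.assoc simp flip: hom_mult\<close>)
    ultimately show ?thesis by simp
  qed
  obtain d0 where d0: "d0 \<in> E" "d0 \<noteq> 0" "\<And>e. e \<in> C \<Longrightarrow> d0 * e \<in> E"
    by (rule common_denominator[OF E E_quotients finC]) blast
  obtain s t where s: "s \<in> S"
    and st: "\<And>g. g \<in> G \<Longrightarrow> \<iota> s * (x * \<iota> (smult d0 (f g))) = \<iota> (t g)"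
    by (rule T_common_denominator[OF fin, of "\<lambda>g. x * \<iota> (smult d0 (f g))"])
      (use x_mult d0 in auto)
  \<comment> \<open>From \<open>s x d0 f_g = t_g\<close> the Bezout relation yields that
    \<open>s x d0\<close> is the sum of the \<open>r_g t_g\<close>.\<close>
  define w where "w = smult (inverse d0) (\<Sum>g\<in>G. r g * t g)"
  have w: "\<iota> s * x = \<iota> w"
  proof -
    have "\<iota> (\<Sum>g\<in>G. r g * t g) = (\<Sum>g\<in>G. \<iota> s * x * \<iota> (smult d0 (r g * f g)))"
      unfolding hom_sum
    proof (rule sum.cong)
      fix g assume "g \<in> G"
      have "\<iota> (smult d0 (r g * f g)) = \<iota> (r g) * \<iota> (smult d0 (f g))"
        by (simp flip: hom_mult)
      then show "\<iota> (r g * t g) = \<iota> s * x * \<iota> (smult d0 (r g * f g))"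
        using st[OF \<open>g \<in> G\<close>] by (simp add: hom_mult algebra_simps)
    qed simp
    also have "\<dots> = \<iota> s * x * \<iota> (smult d0 (\<Sum>g\<in>G. r g * f g))"
    proof -
      have "smult d0 (\<Sum>g\<in>G. r g * f g) = (\<Sum>g\<in>G. smult d0 (r g * f g))"
        by (simp add: poly_eq_iff coeff_sum sum_distrib_left)
      then show ?thesis by (simp only: hom_sum sum_distrib_left)
    qed
    finally have *: "\<iota> (\<Sum>g\<in>G. r g * t g) = \<iota> s * x * \<iota> [:d0:]" by (simp add: r)
    have "\<iota> w = \<iota> [:inverse d0:] * \<iota> (\<Sum>g\<in>G. r g * t g)" by (simp add: w_def flip: hom_mult)
    also have "\<dots> = \<iota> s * x * \<iota> ([:inverse d0:] * [:d0:])" unfolding * hom_mult by (simp add: algebra_simps)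
    also have "[:inverse d0:] * [:d0:] = 1" using d0(2) by simp
    finally show ?thesis by (simp add: hom_1)
  qed
  have "coeff w i \<in> E" for i
  proof -
    have "\<exists>e\<in>C. e \<noteq> 0"
    proof -
      have "f g0 \<noteq> 0" using f[OF g0(1)] g0(2) hom_0 by auto
      moreover have "coeff (f g0) (degree (f g0)) \<in> C" unfolding C_def using g0 by force
      ultimately show ?thesis by (intro bexI[of _ "lead_coeff (f g0)"]) auto
    qed
    then obtain e0 where e0: "e0 \<in> C" "e0 \<noteq> 0" by blast
    show ?thesis
    proof (rule v_closedD[OF v finC e0])
      fix d e assume d: "\<And>e. e \<in> C \<Longrightarrow> d * e \<in> E" and "e \<in> C"
      then obtain g j where g: "g \<in> G" "e = coeff (f g) j" by (auto simp: C_def)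
      have "\<iota> w * \<iota> (smult d (f g)) \<in> T"
        using hom_E_polys_mult_T[OF _ x_mult[of d g], of s] s S_subset_E_polys d g(1) w
        by (auto simp: mult.assoc simp flip: w)
      then obtain s' t' where s': "s' \<in> S" "t' \<in> E_polys" "\<iota> s' * (\<iota> w * \<iota> (smult d (f g))) = \<iota> t'"
        unfolding T_iff by blast
      then have "s' * (w * smult d (f g)) = t'" by (simp only: hom_eq_iff flip: hom_mult)
      with s'(2) have "coeff (s' * (w * smult d (f g))) k \<in> E" for k
        by (simp only: E_polys_def mem_Collect_eq)
      \<comment> \<open>The first use of Gauss's lemma separates \<open>s'\<close> from the product,
        and primitivity of \<open>s'\<close> removes it. The second use separates \<open>w\<close>
        from \<open>d f_g\<close>.\<close>
      from v_closed_gauss[OF E v this]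
      have "coeff (w * smult d (f g)) l * coeff s' k \<in> E" for k l
        by (subst mult.commute)
      then have "coeff (w * smult d (f g)) l \<in> E" for l
        by (rule S_primitive[OF s'(1)])
      from v_closed_gauss[OF E v this] have "coeff w i * coeff (smult d (f g)) j \<in> E" .
      then show "coeff w i * d * e \<in> E" by (simp add: g algebra_simps)
    qed
  qed
  then have "w \<in> E_polys" by (simp add: E_polys_def)
  with s w show "x \<in> T" unfolding T_iff by blast
qed

text \<open>Comparing coefficients in \<open>s x = t\<close> puts every \<open>x s_i\<close> into
  \<open>E\<close>, and primitivity of \<open>s\<close> cancels \<open>s\<close>.\<close>

lemma const_in_T_iff: "\<iota> [:x:] \<in> T \<longleftrightarrow> x \<in> E"
proof
  assume "\<iota> [:x:] \<in> T"
  then obtain s t where s: "s \<in> S" "t \<in> E_polys" "\<iota> s * \<iota> [:x:] = \<iota> t" unfolding T_iff by blast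
  then have "s * [:x:] = t" by (simp only: hom_eq_iff flip: hom_mult)
  with s(2) have "x * coeff s i \<in> E" for i by (auto simp: E_polys_def)
  with s(1) show "x \<in> E" by (rule S_primitive)
next
  assume "x \<in> E"
  then show "\<iota> [:x:] \<in> T"
    by (intro hom_E_polys_in_T) (auto simp: E_polys_def coeff_pCons Es(1) split: nat.split)
qed

text \<open>View \<open>G\<close> as a set of constants in \<open>T\<close>. If \<open>z\<close>
  lies in its inverse over \<open>T\<close>, then \<open>s z = w\<close> for a polynomial
  \<open>w\<close> whose coefficients all lie in the inverse of \<open>G\<close> over
  \<open>E\<close>, so the hypothesis on \<open>x\<close> applies coefficientwise.\<close>

lemma v_closed_contraction:
  assumes v: "v_closed T"
  shows "v_closed E"
  unfolding v_closed_def
proof (intro allI impI, elim conjE bexE)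
  fix G x g0
  assume fin: "finite G" and g0: "g0 \<in> G" "g0 \<noteq> 0"
    and x: "\<forall>z. (\<forall>g\<in>G. z * g \<in> E) \<longrightarrow> (\<forall>g\<in>G. x * z * g \<in> E)"
  have "\<iota> [:x:] \<in> T"
  proof (rule v_closedD[OF v])
    show "finite ((\<lambda>g. \<iota> [:g:]) ` G)" using fin by simp
    show "\<iota> [:g0:] \<in> (\<lambda>g. \<iota> [:g:]) ` G" "\<iota> [:g0:] \<noteq> 0" using g0 by (auto simp: hom_eq_0_iff)
    fix z y assume z: "\<And>y. y \<in> (\<lambda>g. \<iota> [:g:]) ` G \<Longrightarrow> z * y \<in> T" and y: "y \<in> (\<lambda>g. \<iota> [:g:]) ` G"
    obtain g where g: "g \<in> G" "y = \<iota> [:g:]" using y by blast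
    obtain s t where s: "s \<in> S" and t: "\<And>g. g \<in> G \<Longrightarrow> t g \<in> E_polys"
      and st: "\<And>g. g \<in> G \<Longrightarrow> \<iota> s * (z * \<iota> [:g:]) = \<iota> (t g)"
      by (rule T_common_denominator[OF fin, of "\<lambda>g. z * \<iota> [:g:]"]) (use z in auto)
    \<comment> \<open>Here \<open>s z g0 = t g0\<close> with a nonzero constant \<open>g0\<close>,
      so \<open>s z\<close> is itself a polynomial over \<open>K\<close>.\<close>
    define w where "w = smult (inverse g0) (t g0)"
    have w: "\<iota> s * z = \<iota> w"
    proof -
      have "\<iota> w = \<iota> [:inverse g0:] * \<iota> (t g0)" by (simp add: w_def flip: hom_mult)
      also have "\<dots> = \<iota> s * z * \<iota> ([:inverse g0:] * [:g0:])"
        unfolding st[OF g0(1), symmetric] hom_mult by (simp add: algebra_simps)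
      also have "[:inverse g0:] * [:g0:] = 1" using g0(2) by simp
      finally show ?thesis by (simp add: hom_1)
    qed
    have wt: "smult h w = t h" if "h \<in> G" for h
    proof -
      have "\<iota> w * \<iota> [:h:] = \<iota> (t h)" using st[OF that] by (simp only: w flip: mult.assoc)
      then have "w * [:h:] = t h" by (simp only: hom_eq_iff flip: hom_mult)
      then show ?thesis by simp
    qed
    have "x * coeff w i * g \<in> E" for i
    proof (rule x[rule_format])
      fix h assume "h \<in> G"
      then have "coeff (smult h w) i \<in> E" using t by (simp only: wt) (simp add: E_polys_def)
      then show "coeff w i * h \<in> E" by (simp add: mult.commute)
    qed fact
    then have "smult (x * g) w \<in> E_polys" by (simp add: E_polys_def algebra_simps)
    moreover have "\<iota> s * (\<iota> [:x:] * z * y) = \<iota> (smult (x * g) w)"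
    proof -
      have "\<iota> s * (\<iota> [:x:] * z * y) = \<iota> s * z * (\<iota> [:x:] * \<iota> [:g:])" by (simp add: g algebra_simps)
      also have "\<dots> = \<iota> (w * ([:x:] * [:g:]))" by (simp only: w hom_mult)
      finally show ?thesis by (simp add: mult.commute)
    qed
    ultimately show "\<iota> [:x:] * z * y \<in> T" using s unfolding T_iff by blast
  qed
  then show "x \<in> E" by (simp add: const_in_T_iff)
qed

end

section \<open>Prime ideals of a ring and of its localizations\<close>

text \<open>Counterpart of \<open>prime_ideal_of\<close> for a ring that is a whole type, such as
  \<open>D\<close> or \<open>D[X]\<close>, instead of a subset of a field.\<close>

definition prime_set :: "'b::comm_ring_1 set \<Rightarrow> bool" where
  "prime_set q \<longleftrightarrow> 0 \<in> q \<and> 1 \<notin> q \<and> (\<forall>a\<in>q. \<forall>b\<in>q. a + b \<in> q) \<and> (\<forall>r. \<forall>a\<in>q. r * a \<in> q) \<and>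
     (\<forall>a b. a * b \<in> q \<longrightarrow> a \<in> q \<or> b \<in> q)"

definition local_ring_at :: "'b::idom set \<Rightarrow> 'b fract set" where
  "local_ring_at q = {Fract f g | f g. g \<notin> q}"

lemma prime_setD:
  assumes "prime_set q"
  shows "0 \<in> q" "1 \<notin> q" "a \<in> q \<Longrightarrow> b \<in> q \<Longrightarrow> a + b \<in> q" "a \<in> q \<Longrightarrow> r * a \<in> q"
    "a * b \<in> q \<Longrightarrow> a \<in> q \<or> b \<in> q" "a \<notin> q \<Longrightarrow> a \<noteq> 0"
  using assms unfolding prime_set_def by blast+

lemma prime_set_mult_iff: "prime_set q \<Longrightarrow> a * b \<in> q \<longleftrightarrow> a \<in> q \<or> b \<in> q"
  using prime_setD(4,5) mult.commute by metis

lemma local_ring_atI: "g \<notin> q \<Longrightarrow> Fract f g \<in> local_ring_at q"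
  unfolding local_ring_at_def by blast

lemma local_ring_atE:
  assumes "x \<in> local_ring_at q"
  obtains f g where "x = Fract f g" "g \<notin> q"
  using assms unfolding local_ring_at_def by blast

lemma subring_local_ring_at:
  assumes q: "prime_set q"
  shows "subring_of (local_ring_at q)"
proof -
  have "x + y \<in> local_ring_at q \<and> x - y \<in> local_ring_at q \<and> x * y \<in> local_ring_at q"
    if "x \<in> local_ring_at q" "y \<in> local_ring_at q" for x y
    using that
    by (elim local_ring_atE)
      (auto simp: prime_setD(6)[OF q] prime_set_mult_iff[OF q] intro!: local_ring_atI)
  then show ?thesis
    unfolding subring_of_def Zero_fract_def One_fract_def
    using prime_setD(2)[OF q] by (auto intro: local_ring_atI)
qed

lemma local_ring_at_quotients:
  assumes q: "prime_set q"
  shows "\<exists>d\<in>local_ring_at q. d \<noteq> 0 \<and> d * x \<in> local_ring_at q"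
proof (cases x)
  case (Fract a b)
  have "Fract b 1 * x = Fract a 1" "Fract b 1 \<noteq> 0"
    using Fract by (simp_all add: Zero_fract_def eq_fract)
  then show ?thesis using local_ring_atI[OF prime_setD(2)[OF q]] by metis
qed

lemma v_domain_local_ring_at_iff:
  "prime_set q \<Longrightarrow> v_domain (local_ring_at q) \<longleftrightarrow> v_closed (local_ring_at q)"
  by (intro v_domain_iff_v_closed subring_local_ring_at local_ring_at_quotients)

section \<open>Primes of a localization and primes disjoint from the multiplicative set\<close>

context
  fixes A :: "'b::idom set" and R :: "'b fract set"
  assumes A_one: "1 \<in> A" and A_mult: "\<And>a b. a \<in> A \<Longrightarrow> b \<in> A \<Longrightarrow> a * b \<in> A" and A_zero: "0 \<notin> A"
  defines "R \<equiv> localization (range (\<lambda>f. Fract f 1)) {Fract g 1 | g. g \<in> A}"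
begin

lemma localization_eq: "R = {Fract f g | f g. g \<in> A}"
proof -
  have "Fract f g = Fract f 1 / Fract g 1" for f g :: 'b by simp
  then show ?thesis unfolding R_def localization_def by fastforce
qed

lemma FractI: "g \<in> A \<Longrightarrow> Fract f g \<in> R"
  unfolding localization_eq by blast

text \<open>Elements of \<open>A\<close> become units of \<open>R\<close>. Hence \<open>Q\<close>
  contains none of them, and whether a fraction lies in \<open>Q\<close> depends on its numerator
  alone.\<close>

lemma prime_ideal_contraction:
  assumes Q: "prime_ideal_of R Q"
  defines "q \<equiv> {f. Fract f 1 \<in> Q}"
  shows "prime_set q" "q \<inter> A = {}" "localization R (R - Q) = local_ring_at q"
proof -
  have Q0: "0 \<in> Q" and QR: "Q \<subseteq> R" and Qadd: "\<And>x y. x \<in> Q \<Longrightarrow> y \<in> Q \<Longrightarrow> x + y \<in> Q"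
    and Qmult: "\<And>r x. r \<in> R \<Longrightarrow> x \<in> Q \<Longrightarrow> r * x \<in> Q" and Qne: "Q \<noteq> R"
    and Qprime: "\<And>a b. a \<in> R \<Longrightarrow> b \<in> R \<Longrightarrow> a * b \<in> Q \<Longrightarrow> a \<in> Q \<or> b \<in> Q"
    using Q unfolding prime_ideal_of_def ideal_of_def by blast+
  have disj: "f \<notin> q" if "f \<in> A" for f
  proof
    assume "f \<in> q"
    have "x \<in> Q" if xR: "x \<in> R" for x
    proof -
      obtain a b where x: "x = Fract a b" "b \<in> A" using xR unfolding localization_eq by blast
      have "Fract a (b * f) * Fract f 1 = x"
      proof -
        have "b \<noteq> 0" "f \<noteq> 0" using x(2) \<open>f \<in> A\<close> A_zero by auto
        then show ?thesis by (simp add: x(1) eq_fract)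
      qed
      with Qmult[OF FractI[OF A_mult[OF x(2) \<open>f \<in> A\<close>]]] \<open>f \<in> q\<close> show ?thesis
        unfolding q_def by (metis mem_Collect_eq)
    qed
    with QR Qne show False by blast
  qed
  then show "q \<inter> A = {}" by blast
  have in_q: "f \<in> q \<longleftrightarrow> Fract f g \<in> Q" if g: "g \<in> A" for f g
  proof -
    have "g \<noteq> 0" using g A_zero by auto
    then have "Fract g 1 * Fract f g = Fract f 1" "Fract 1 g * Fract f 1 = Fract f g"
      by (simp_all add: eq_fract)
    then show ?thesis
      using Qmult[OF FractI[OF A_one], of "Fract f g" g] Qmult[OF FractI[OF g], of "Fract f 1" 1]
      unfolding q_def mem_Collect_eq by metis
  qed
  show prime: "prime_set q"
    unfolding prime_set_def
  proof (intro conjI ballI allI impI)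
    show "0 \<in> q" using Q0 by (simp add: q_def Zero_fract_def)
    show "1 \<notin> q" by (rule disj[OF A_one])
    show "a + b \<in> q" if "a \<in> q" "b \<in> q" for a b
      using Qadd[of "Fract a 1" "Fract b 1"] that by (simp add: q_def)
    show "r * a \<in> q" if "a \<in> q" for r a
      using Qmult[OF FractI[OF A_one], of "Fract a 1" r] that by (simp add: q_def)
    show "a \<in> q \<or> b \<in> q" if "a * b \<in> q" for a b
      using Qprime[OF FractI[OF A_one] FractI[OF A_one], of a b] that by (simp add: q_def)
  qed
  show "localization R (R - Q) = local_ring_at q"
  proof (intro equalityI subsetI)
    fix x assume "x \<in> localization R (R - Q)"
    then obtain a s where x: "x = a / s" "a \<in> R" "s \<in> R" "s \<notin> Q" unfolding localization_def by blast
    then obtain f g f' g' where fg: "a = Fract f g" "g \<in> A" "s = Fract f' g'" "g' \<in> A"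
      unfolding localization_eq by blast
    \<comment> \<open>Here \<open>x\<close> is the fraction of \<open>f g'\<close> by
      \<open>g f'\<close>; the denominator avoids \<open>q\<close> because \<open>g\<close> is in
      \<open>A\<close> and \<open>f' / g'\<close> is outside \<open>Q\<close>.\<close>
    have "g * f' \<notin> q"
      using disj[OF fg(2)] in_q[OF fg(4), of f'] x(4) unfolding fg(3) prime_set_mult_iff[OF prime] by blast
    then show "x \<in> local_ring_at q" using x fg by (auto intro: local_ring_atI)
  next
    fix x assume "x \<in> local_ring_at q"
    then obtain f g where x: "x = Fract f g" "g \<notin> q" by (rule local_ring_atE)
    then have "x = Fract f 1 / Fract g 1" "Fract g 1 \<notin> Q" by (simp_all add: q_def)
    then show "x \<in> localization R (R - Q)" unfolding localization_def using FractI[OF A_one] by blast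
  qed
qed

text \<open>Numerators depend on the chosen representation, whence \<open>in_Q\<close>: from
  \<open>f / g = f' / g'\<close> with \<open>f'\<close> in \<open>q\<close> it follows that
  \<open>f g'\<close> is in \<open>q\<close>, and \<open>g'\<close>, being in \<open>A\<close>, lies
  outside \<open>q\<close> and can be cancelled.\<close>

lemma prime_ideal_extension:
  assumes q: "prime_set q" and disj: "q \<inter> A = {}"
  defines "Q \<equiv> {Fract f g | f g. f \<in> q \<and> g \<in> A}"
  shows "prime_ideal_of R Q" "{f. Fract f 1 \<in> Q} = q"
proof -
  have in_Q: "f \<in> q" if fg: "Fract f g \<in> Q" "g \<in> A" for f g
  proof -
    obtain f' g' where *: "Fract f g = Fract f' g'" "f' \<in> q" "g' \<in> A" using fg(1) unfolding Q_def by blast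
    then have "f * g' = g * f'"
      using fg(2) A_zero by (subst (asm) eq_fract(1)) (auto simp: mult.commute)
    then have "f * g' \<in> q" using *(2) prime_setD(4)[OF q] by simp
    then show ?thesis using prime_setD(5)[OF q] disj *(3) by blast
  qed
  have QI: "Fract f g \<in> Q" if "f \<in> q" "g \<in> A" for f g
    using that unfolding Q_def by blast
  show contr: "{f. Fract f 1 \<in> Q} = q"
    using in_Q QI A_one by blast
  show "prime_ideal_of R Q"
    unfolding prime_ideal_of_def ideal_of_def
  proof (intro conjI ballI impI)
    show "Q \<subseteq> R" unfolding Q_def using FractI by blast
    show "0 \<in> Q" unfolding Zero_fract_def by (rule QI[OF prime_setD(1)[OF q] A_one])
    show "x + y \<in> Q" if xy: "x \<in> Q" "y \<in> Q" for x y
    proof -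
      obtain a b c d where *: "x = Fract a b" "y = Fract c d" "a \<in> q" "b \<in> A" "c \<in> q" "d \<in> A"
        using xy unfolding Q_def by blast
      then have "a * d + c * b \<in> q" "b * d \<in> A" "b \<noteq> 0" "d \<noteq> 0"
        using prime_setD(3)[OF q] prime_set_mult_iff[OF q] A_mult A_zero by auto
      with * QI show ?thesis by simp
    qed
    show "r * x \<in> Q" if rx: "r \<in> R" "x \<in> Q" for r x
    proof -
      obtain a b c d where "r = Fract a b" "b \<in> A" "x = Fract c d" "c \<in> q" "d \<in> A"
        using rx unfolding localization_eq Q_def by blast
      then show ?thesis using QI prime_setD(4)[OF q] A_mult by simp
    qed
    show "Q \<noteq> R"
      using in_Q[OF _ A_one, of 1] FractI[OF A_one, of 1] prime_setD(2)[OF q] by blast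
    show "x \<in> Q \<or> y \<in> Q" if xy: "x \<in> R" "y \<in> R" "x * y \<in> Q" for x y
    proof -
      obtain a b c d where *: "x = Fract a b" "b \<in> A" "y = Fract c d" "d \<in> A"
        using xy unfolding localization_eq by blast
      then have "a * c \<in> q" using in_Q[of "a * c" "b * d"] xy(3) A_mult by simp
      then show ?thesis using * QI prime_setD(5)[OF q] by blast
    qed
  qed
qed

text \<open>This is applied with \<open>A = {1}\<close> to treat \<open>D\<close> itself, and with
  the polynomials of constant term 1.\<close>

lemma locally_v_domain_localization_iff:
  "locally_v_domain R \<longleftrightarrow> (\<forall>q. prime_set q \<and> q \<inter> A = {} \<longrightarrow> v_domain (local_ring_at q))"
proof
  assume R: "locally_v_domain R"
  show "\<forall>q. prime_set q \<and> q \<inter> A = {} \<longrightarrow> v_domain (local_ring_at q)"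
  proof (intro allI impI, elim conjE)
    fix q assume q: "prime_set q" "q \<inter> A = {}"
    note Q = prime_ideal_extension[OF q]
    have "v_domain (localization R (R - {Fract f g | f g. f \<in> q \<and> g \<in> A}))"
      using R Q(1) unfolding locally_v_domain_def by blast
    then show "v_domain (local_ring_at q)"
      by (simp only: prime_ideal_contraction(3)[OF Q(1)] Q(2))
  qed
next
  assume "\<forall>q. prime_set q \<and> q \<inter> A = {} \<longrightarrow> v_domain (local_ring_at q)"
  then show "locally_v_domain R"
    unfolding locally_v_domain_def by (simp add: prime_ideal_contraction)
qed

end

section \<open>Primes of a polynomial ring\<close>

text \<open>\<open>M\<close> will be the set of nonzero elements when \<open>K[X]\<close> is
  embedded, and the complement of a prime \<open>p\<close> when polynomials over \<open>D_p\<close>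
  are compared with \<open>D[X]\<close>.\<close>

lemma poly_common_denominator:
  assumes M: "1 \<in> M" "\<And>a b. a \<in> M \<Longrightarrow> b \<in> M \<Longrightarrow> a * b \<in> M" "0 \<notin> M"
    and "\<And>i. \<exists>a. \<exists>b\<in>M. coeff p i = Fract a b"
  shows "\<exists>d\<in>M. \<exists>q. smult (to_fract d) p = fract_poly q"
  using assms(4)
proof (induction p)
  case 0
  show ?case using M(1) by (intro bexI[of _ 1] exI[of _ 0]) auto
next
  case (pCons c p)
  have "\<exists>a. \<exists>b\<in>M. coeff p i = Fract a b" for i using pCons.prems[of "Suc i"] by simp
  then obtain d q where d: "d \<in> M" "smult (to_fract d) p = fract_poly q" using pCons.IH by blast
  obtain a b where ab: "b \<in> M" "c = Fract a b" using pCons.prems[of 0] by auto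
  have b: "b \<noteq> 0" using ab(1) M(3) by auto
  have "to_fract (b * d) * c = to_fract (d * a)"
    using b by (simp add: ab(2) Fract_conv_to_fract)
  moreover have "smult (to_fract (b * d)) p = fract_poly (smult b q)"
    by (simp flip: d(2))
  ultimately have "smult (to_fract (b * d)) (pCons c p) = fract_poly (pCons (d * a) (smult b q))"
    by (simp add: map_poly_pCons del: to_fract_mult fract_poly_smult)
  then show ?case using M(2)[OF ab(1) d(1)] by blast
qed

text \<open>The canonical embedding of \<open>K[X]\<close> into the quotient field of
  \<open>D[X]\<close>, where \<open>K\<close> is the quotient field of \<open>D\<close>. An
  arbitrary denominator is chosen; the next lemma shows that the value does not depend on
  it.\<close>

definition fract_poly_embed :: "'a::idom fract poly \<Rightarrow> 'a poly fract" where
  "fract_poly_embed p =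
     (SOME y. \<exists>d q. d \<noteq> 0 \<and> smult (to_fract d) p = fract_poly q \<and> y = Fract q [:d:])"

text \<open>Two clearings \<open>d p = q\<close> and \<open>e p = r\<close> cross-multiply to
  \<open>d r = e q\<close>, an identity that descends to \<open>D[X]\<close> by injectivity of
  \<open>fract_poly\<close>.\<close>

lemma fract_poly_embed_eq:
  assumes d: "d \<noteq> 0" "smult (to_fract d) p = fract_poly q"
  shows "fract_poly_embed p = Fract q [:d:]"
proof -
  have "\<exists>d q. d \<noteq> 0 \<and> smult (to_fract d) p = fract_poly q \<and> fract_poly_embed p = Fract q [:d:]"
    unfolding fract_poly_embed_def by (rule someI_ex) (use d in blast)
  then obtain e r where e: "e \<noteq> 0" "smult (to_fract e) p = fract_poly r"
    and *: "fract_poly_embed p = Fract r [:e:]" by blast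
  have "fract_poly (smult d r) = smult (to_fract d) (smult (to_fract e) p)"
    by (simp add: e(2))
  also have "\<dots> = smult (to_fract e) (smult (to_fract d) p)"
    by (simp add: mult.commute)
  also have "\<dots> = fract_poly (smult e q)"
    by (simp add: d(2))
  finally have "smult d r = smult e q" by (simp only: fract_poly_eq_iff)
  then show ?thesis using d(1) e(1) by (simp add: * eq_fract)
qed

lemma fract_poly_denominator: "\<exists>d q. d \<noteq> 0 \<and> smult (to_fract d) p = fract_poly q"
proof -
  have "\<exists>a. \<exists>b\<in>-{0}. coeff p i = Fract a b" for i
    by (cases "coeff p i") auto
  then show ?thesis using poly_common_denominator[of "-{0}" p] by auto
qed

lemma fract_poly_embed_fract_poly [simp]: "fract_poly_embed (fract_poly q) = Fract q 1"
  using fract_poly_embed_eq[of 1 "fract_poly q" q] by (simp add: one_pCons)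

lemma fract_poly_embed_add: "fract_poly_embed (p + q) = fract_poly_embed p + fract_poly_embed q"
proof -
  obtain d a where d: "d \<noteq> 0" "smult (to_fract d) p = fract_poly a" using fract_poly_denominator by blast
  obtain e b where e: "e \<noteq> 0" "smult (to_fract e) q = fract_poly b" using fract_poly_denominator by blast
  have "smult (to_fract (d * e)) (p + q) = fract_poly (smult e a + smult d b)"
    by (simp add: smult_add_right mult.commute flip: d(2) e(2))
  from fract_poly_embed_eq[OF _ this] fract_poly_embed_eq[OF d] fract_poly_embed_eq[OF e]
  show ?thesis using d(1) e(1) by (simp add: mult.commute)
qed

lemma fract_poly_embed_mult: "fract_poly_embed (p * q) = fract_poly_embed p * fract_poly_embed q"
proof -
  obtain d a where d: "d \<noteq> 0" "smult (to_fract d) p = fract_poly a" using fract_poly_denominator by blast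
  obtain e b where e: "e \<noteq> 0" "smult (to_fract e) q = fract_poly b" using fract_poly_denominator by blast
  have "smult (to_fract (d * e)) (p * q) = fract_poly (a * b)"
    by (simp add: mult.commute flip: d(2) e(2))
  from fract_poly_embed_eq[OF _ this] fract_poly_embed_eq[OF d] fract_poly_embed_eq[OF e]
  show ?thesis using d(1) e(1) by (simp add: mult.commute)
qed

lemma fract_poly_embed_eq_0D: "fract_poly_embed p = 0 \<Longrightarrow> p = 0"
proof -
  assume *: "fract_poly_embed p = 0"
  obtain d a where d: "d \<noteq> 0" "smult (to_fract d) p = fract_poly a" using fract_poly_denominator by blast
  then have "a = 0" using * fract_poly_embed_eq[OF d] by (simp add: Zero_fract_def eq_fract)
  then show "p = 0" using d by simp
qed

section \<open>Comparison of the local rings at a prime of \<open>D[X]\<close> and at its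
  contraction to \<open>D\<close>\<close>

lemma prime_set_const_contraction:
  assumes "prime_set q"
  shows "prime_set {a. [:a:] \<in> q}"
proof -
  have *: "[:a + b:] = [:a:] + [:b:]" "[:a * b:] = [:a:] * [:b:]" for a b :: 'a by simp_all
  have "[:0:] \<in> q" "[:1:] \<notin> q"
    using prime_setD(1,2)[OF assms] by (simp_all add: one_pCons)
  with prime_setD(3-5)[OF assms] show ?thesis
    unfolding prime_set_def mem_Collect_eq Ball_def * by blast
qed

lemma poly_in_prime_set:
  assumes q: "prime_set q" and "\<And>i. [:coeff s i:] \<in> q"
  shows "s \<in> q"
  using assms(2)
proof (induction s)
  case 0
  show ?case by (rule prime_setD(1)[OF q])
next
  case (pCons a s)
  have "s \<in> q" using pCons.prems[of "Suc _"] by (intro pCons.IH) simp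
  then have "[:a:] + [:0, 1:] * s \<in> q"
    using pCons.prems[of 0] by (intro prime_setD(3,4)[OF q]) simp_all
  then show ?case by simp
qed

text \<open>A polynomial outside \<open>q\<close> has a coefficient outside \<open>p = q \<inter> D\<close>, that is, a coefficient which
  is a unit of \<open>D\<^sub>p\<close>.\<close>
lemma v_domain_local_ring_at_poly_iff:
  fixes q :: "'a::idom poly set"
  assumes q: "prime_set q"
  defines "p \<equiv> {a. [:a:] \<in> q}"
  shows "v_domain (local_ring_at q) \<longleftrightarrow> v_domain (local_ring_at p)"
proof -
  have p: "prime_set p" unfolding p_def by (rule prime_set_const_contraction[OF q])
  have to_fract: "to_fract a \<in> local_ring_at p" for a
    unfolding to_fract_def by (rule local_ring_atI[OF prime_setD(2)[OF p]])
  \<comment> \<open>Here \<open>E\<close> is \<open>D_p\<close>, and \<open>S\<close> is the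
    complement of \<open>q\<close> in \<open>D[X]\<close>, viewed inside
    \<open>K[X]\<close>.\<close>
  interpret primitive_localization fract_poly_embed "local_ring_at p" "fract_poly ` (- q)"
  proof
    show "fract_poly_embed (1 :: 'a fract poly) = 1"
      using fract_poly_embed_fract_poly[of 1] by (simp add: One_fract_def)
    show "\<exists>p q. q \<noteq> 0 \<and> x * fract_poly_embed q = fract_poly_embed p" for x :: "'a poly fract"
    proof (cases x)
      case (Fract a b)
      then show ?thesis
        by (intro exI[of _ "fract_poly a"] exI[of _ "fract_poly b"]) (simp add: eq_fract)
    qed
    show "(1 :: 'a fract poly) \<in> fract_poly ` (- q)"
      using prime_setD(2)[OF q] by (intro image_eqI[of _ _ 1]) auto
    show "s * t \<in> fract_poly ` (- q)" if st: "s \<in> fract_poly ` (- q)" "t \<in> fract_poly ` (- q)" for s t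
    proof -
      obtain a b where "s = fract_poly a" "t = fract_poly b" "a \<notin> q" "b \<notin> q" using st by auto
      then show ?thesis using prime_set_mult_iff[OF q] by (intro image_eqI[of _ _ "a * b"]) auto
    qed
    show "(0 :: 'a fract poly) \<notin> fract_poly ` (- q)"
      using prime_setD(1)[OF q] by auto
    show "coeff s i \<in> local_ring_at p" if "s \<in> fract_poly ` (- q)" for s i
      using that to_fract by (auto simp: coeff_map_poly)
    show "y \<in> local_ring_at p" if s: "s \<in> fract_poly ` (- q)"
      and y: "\<And>i. y * coeff s i \<in> local_ring_at p" for s y
    proof -
      obtain s' where s': "s = fract_poly s'" "s' \<notin> q" using s by auto
      then obtain i where i: "coeff s' i \<notin> p" using poly_in_prime_set[OF q, of s'] by (auto simp: p_def)
      have "y * to_fract (coeff s' i) \<in> local_ring_at p"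
        using y[of i] by (simp add: s' coeff_map_poly)
      then obtain a b where ab: "y * to_fract (coeff s' i) = Fract a b" "b \<notin> p" by (rule local_ring_atE)
      have "to_fract (coeff s' i) \<noteq> 0" using prime_setD(6)[OF p i] by simp
      then have "y = Fract a b / to_fract (coeff s' i)" by (simp flip: ab(1))
      then have "y = Fract a (b * coeff s' i)" by (simp add: to_fract_def)
      then show ?thesis using ab(2) i prime_set_mult_iff[OF p] by (auto intro: local_ring_atI)
    qed
  qed (fact fract_poly_embed_add fract_poly_embed_mult fract_poly_embed_eq_0D
      subring_local_ring_at[OF p] local_ring_at_quotients[OF p])+
  \<comment> \<open>The coefficients of a polynomial over \<open>D_p\<close> have a common
    denominator \<open>d\<close> outside \<open>p\<close>. As a constant, \<open>d\<close> lies
    outside \<open>q\<close> and can be absorbed into the denominator.\<close>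
  have "T = local_ring_at q"
  proof (intro equalityI subsetI)
    fix x assume "x \<in> T"
    then obtain t s where x: "x = fract_poly_embed t / Fract s 1" "t \<in> E_polys" "s \<notin> q"
      unfolding T_def by auto
    have "\<exists>d\<in>-p. \<exists>r. smult (to_fract d) t = fract_poly r"
    proof (rule poly_common_denominator)
      fix i
      have "coeff t i \<in> local_ring_at p" using x(2) by (simp add: E_polys_def)
      then show "\<exists>a. \<exists>b\<in>-p. coeff t i = Fract a b" by (rule local_ring_atE) blast
    qed (use prime_setD(1,2)[OF p] prime_set_mult_iff[OF p] in auto)
    then obtain d r where d: "d \<notin> p" "smult (to_fract d) t = fract_poly r" by auto
    have "x = Fract r ([:d:] * s)"
      using fract_poly_embed_eq[OF prime_setD(6)[OF p d(1)] d(2)] by (simp add: x(1))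
    moreover have "[:d:] * s \<notin> q"
      using d(1) x(3) unfolding prime_set_mult_iff[OF q] p_def by simp
    ultimately show "x \<in> local_ring_at q" by (auto intro: local_ring_atI simp del: mult_pCons_left)
  next
    fix x assume "x \<in> local_ring_at q"
    then obtain f g where x: "x = Fract f g" "g \<notin> q" by (rule local_ring_atE)
    have "x = fract_poly_embed (fract_poly f) / fract_poly_embed (fract_poly g)" by (simp add: x(1))
    moreover have "fract_poly f \<in> E_polys"
      using to_fract by (auto simp: E_polys_def coeff_map_poly)
    ultimately show "x \<in> T" unfolding T_def using x(2) by blast
  qed
  then show ?thesis
    using v_closed_localization v_closed_contraction
    unfolding v_domain_local_ring_at_iff[OF p] v_domain_local_ring_at_iff[OF q] by auto
qed

text \<open>This is the ideal \<open>p + X D[X]\<close>, the preimage of \<open>p\<close> under the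
  ring homomorphism of evaluation at 0.\<close>

lemma prime_set_const_coeff:
  assumes "prime_set p"
  shows "prime_set {f. poly f 0 \<in> p}"
  using assms unfolding prime_set_def by simp

theorem mainTheorem20:
  shows "locally_v_domain
           (localization (range (\<lambda>f::'a::idom poly. Fract f 1))
                         {Fract g 1 | g. poly g 0 = 1})
         \<longleftrightarrow> locally_v_domain (range (\<lambda>a::'a. Fract a 1))"
proof -
  \<comment> \<open>\<open>D\<close> is treated as its own localization at \<open>{1}\<close>, a set
    that every prime avoids.\<close>
  have "range (\<lambda>a::'a. Fract a 1)
      = localization (range (\<lambda>a. Fract a 1)) {Fract g 1 | g. g \<in> {1}}"
    by (auto simp: localization_def simp flip: One_fract_def)
  moreover have "prime_set p \<and> p \<inter> {1} = {} \<longleftrightarrow> prime_set p" for p :: "'a set"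
    by (auto simp: prime_set_def)
  ultimately have D: "locally_v_domain (range (\<lambda>a::'a. Fract a 1))
      \<longleftrightarrow> (\<forall>p::'a set. prime_set p \<longrightarrow> v_domain (local_ring_at p))"
    using locally_v_domain_localization_iff[of "{1::'a}"] by simp
  have DX: "locally_v_domain (localization (range (\<lambda>f::'a poly. Fract f 1))
        {Fract g 1 | g. poly g 0 = 1})
      \<longleftrightarrow> (\<forall>q::'a poly set. prime_set q \<and> q \<inter> {g. poly g 0 = 1} = {} \<longrightarrow> v_domain (local_ring_at q))"
    using locally_v_domain_localization_iff[of "{g::'a poly. poly g 0 = 1}"] by simp
  show ?thesis
    unfolding D DX
  proof safe
    fix p :: "'a set"
    assume *: "\<forall>q::'a poly set. prime_set q \<and> q \<inter> {g. poly g 0 = 1} = {} \<longrightarrow> v_domain (local_ring_at q)"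
      and p: "prime_set p"
    let ?q = "{f. poly f 0 \<in> p}"
    have "?q \<inter> {g. poly g 0 = 1} = {}" using prime_setD(2)[OF p] by auto
    with *[THEN spec, of ?q] prime_set_const_coeff[OF p] have "v_domain (local_ring_at ?q)" by simp
    moreover have "{a. [:a:] \<in> ?q} = p" by simp
    ultimately show "v_domain (local_ring_at p)"
      using v_domain_local_ring_at_poly_iff[OF prime_set_const_coeff[OF p]] by simp
  next
    fix q :: "'a poly set"
    assume "\<forall>p::'a set. prime_set p \<longrightarrow> v_domain (local_ring_at p)" "prime_set q"
    then show "v_domain (local_ring_at q)"
      using v_domain_local_ring_at_poly_iff prime_set_const_contraction by blast
  qed
qed

end
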